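(* Let $n\ge 1$ and let $k,m$ be integers with $0\le m<k\le n$. Let $s_1(\theta),\dots,s_n(\theta)$ be real-valued functions of a parameter $\theta\in\mathbb{R}^d$, and suppose that $s_i(\theta)$ is convex with respect to $\theta$ for every $i\in\{1,\dots,n\}$. Let $S(\theta)=\{s_1(\theta),\dots,s_n(\theta)\}$. Then $$\min_{\theta}\psi_{m,k}(S(\theta)) = \min_{\theta}\bigg[ \min_{\lambda\in \mathbb{R}}\Big\{k\lambda+\sum_{i=1}^n[s_i(\theta)-\lambda]_+\Big\}-\min_{\hat{\lambda}\in \mathbb{R}}\Big\{m\hat{\lambda}+\sum_{i=1}^n[s_i(\theta)-\hat{\lambda}]_+\Big\}\bigg].$$ Furthermore, $\hat{\lambda}>\lambda$ when the optimal solution is achieved.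
   Context: For a finite collection (with multiplicity) of real numbers $S=\{s_1,\dots,s_n\}$, $s_{[i]}$ denotes the $i$-th largest value after sorting the elements of $S$ in decreasing order (ties broken in any consistent way). For integers $0\le m<k\le n$, the sum of the $(m,k)$-ranked range is $\psi_{m,k}(S)=\sum_{i=m+1}^{k}s_{[i]}$. The hinge function is $[a]_+=\max\{0,a\}$.
   Formalization: The clause λ̂>λ fails with ties (n=3, k=2, m=1, all s_i=0 gives λ=λ̂=0). Instead: λ≤λ̂ for all optimal pairs; some optimal pair has λ<λ̂ iff m=0, k=n or s_[k+1]<s_[m]; all do iff s_[k]<s_[m+1]. *)

theory Defs
  imports "HOL-Analysis.Analysis" "HOL-Library.Multiset"
begin

text \<open>The rank \<open>i\<close> is 1-based and counted from the top; the value is unspecified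
  unless \<open>1 \<le> i \<le> size S\<close>.\<close>
definition ranked_value :: "real multiset \<Rightarrow> nat \<Rightarrow> real" where
  "ranked_value S i = rev (sorted_list_of_multiset S) ! (i - 1)"

definition ranked_range_sum :: "nat \<Rightarrow> nat \<Rightarrow> real multiset \<Rightarrow> real" where
  "ranked_range_sum m k S = (\<Sum>i = m + 1..k. ranked_value S i)"

definition hinge :: "real \<Rightarrow> real" where
  "hinge a = max 0 a"

definition score_mset :: "nat \<Rightarrow> (nat \<Rightarrow> 'a \<Rightarrow> real) \<Rightarrow> 'a \<Rightarrow> real multiset" where
  "score_mset n s \<theta> = image_mset (\<lambda>i. s i \<theta>) (mset_set {1..n})"

definition hinge_objective :: "nat \<Rightarrow> nat \<Rightarrow> (nat \<Rightarrow> 'a \<Rightarrow> real) \<Rightarrow> 'a \<Rightarrow> real \<Rightarrow> real" where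
  "hinge_objective j n s \<theta> t = real j * t + (\<Sum>i = 1..n. hinge (s i \<theta> - t))"

text \<open>Both infima range over all of \<open>\<real>\<close>; they are minima exactly when the
  respective objective has a minimizer.\<close>
definition hinge_difference :: "nat \<Rightarrow> nat \<Rightarrow> nat \<Rightarrow> (nat \<Rightarrow> 'a \<Rightarrow> real) \<Rightarrow> 'a \<Rightarrow> real" where
  "hinge_difference m k n s \<theta> =
     (INF t. hinge_objective k n s \<theta> t) - (INF u. hinge_objective m n s \<theta> u)"

abbreviation minimizes :: "('a \<Rightarrow> 'b::ord) \<Rightarrow> 'a \<Rightarrow> bool" where
  "minimizes f x \<equiv> is_arg_min f (\<lambda>_. True) x"

end

theory Submission
  imports Defs
begin

text \<open>Write \<open>a\<^sub>1 \<ge> \<dots> \<ge> a\<^sub>n\<close> for the sorted scores at a fixed \<open>\<theta>\<close>. Since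
  \<open>[x]\<^sub>+ = x + [-x]\<^sub>+\<close>, the objective with parameter \<open>j\<close> at \<open>t\<close> equals
  \<open>(\<Sum>i\<le>j. a\<^sub>i) + (\<Sum>i\<le>j. [t - a\<^sub>i]\<^sub>+) + (\<Sum>j<i\<le>n. [a\<^sub>i - t]\<^sub>+)\<close>, so its minimum is the sum of the
  \<open>j\<close> largest scores, attained exactly for \<open>a\<^sub>j\<^sub>+\<^sub>1 \<le> t \<le> a\<^sub>j\<close> (with \<open>a\<^sub>0 = \<infinity>\<close>, \<open>a\<^sub>n\<^sub>+\<^sub>1 = -\<infinity>\<close>).
  Hence both sides agree pointwise in \<open>\<theta>\<close>, and the comparison of minimizers reduces to
  comparing the intervals for \<open>k\<close> and \<open>m\<close>.\<close>

text \<open>Ranking merely permutes the scores, so a sum over all of them may be taken by rank; this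
  brings the hinge sum, indexed by the functions, into sorted order.\<close>

lemma sum_ranked_value:
  fixes f :: "real \<Rightarrow> 'b::comm_monoid_add"
  shows "(\<Sum>i = 1..size S. f (ranked_value S i)) = (\<Sum>x\<in>#S. f x)"
proof -
  define xs where "xs = rev (sorted_list_of_multiset S)"
  have xs: "mset xs = S" "length xs = size S"
    unfolding xs_def by (simp, metis length_rev mset_sorted_list_of_multiset size_mset)
  have "(\<Sum>i = 1..size S. f (ranked_value S i)) = (\<Sum>i<length xs. f (xs ! i))"
    by (rule sum.reindex_bij_witness[where i=Suc and j="\<lambda>i. i - 1"])
      (auto simp: ranked_value_def xs xs_def[symmetric])
  also have "\<dots> = sum_list (map f xs)"
    by (simp add: sum_list_sum_nth atLeast0LessThan)
  also have "\<dots> = (\<Sum>x\<in>#S. f x)"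
    using xs(1) by (metis mset_map sum_mset_sum_list)
  finally show ?thesis .
qed

lemma ranked_value_antimono:
  assumes "1 \<le> i" "i \<le> j" "j \<le> size S"
  shows "ranked_value S j \<le> ranked_value S i"
proof -
  define xs where "xs = sorted_list_of_multiset S"
  have xs: "sorted xs" "length xs = size S"
    unfolding xs_def by (simp, metis mset_sorted_list_of_multiset size_mset)
  then show ?thesis
    unfolding ranked_value_def xs_def[symmetric]
    using assms by (simp add: rev_nth sorted_nth_mono)
qed

lemma size_score_mset [simp]: "size (score_mset n s \<theta>) = n"
  by (simp add: score_mset_def)

lemma hinge_objective_ranked:
  fixes s :: "nat \<Rightarrow> 'a \<Rightarrow> real" and \<theta> :: 'a
  assumes "j \<le> n"
  defines "a \<equiv> ranked_value (score_mset n s \<theta>)"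
  shows "hinge_objective j n s \<theta> t = (\<Sum>i = 1..j. a i)
    + ((\<Sum>i = 1..j. hinge (t - a i)) + (\<Sum>i = j + 1..n. hinge (a i - t)))"
proof -
  have "(\<Sum>i = 1..n. hinge (s i \<theta> - t)) = (\<Sum>x\<in>#score_mset n s \<theta>. hinge (x - t))"
    by (simp add: score_mset_def sum_unfold_sum_mset image_mset.compositionality o_def)
  also have "\<dots> = (\<Sum>i = 1..n. hinge (a i - t))"
    using sum_ranked_value[of "\<lambda>x. hinge (x - t)" "score_mset n s \<theta>"] by (simp add: a_def)
  also have "\<dots> = (\<Sum>i = 1..j. hinge (a i - t)) + (\<Sum>i = j + 1..n. hinge (a i - t))"
    using sum.ub_add_nat[of 1 j "\<lambda>i. hinge (a i - t)" "n - j"] assms(1) by simp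
  \<comment> \<open>On the top \<open>j\<close> ranks, \<open>hinge x = x + hinge (- x)\<close> is
    applied; the \<open>j\<close> copies of \<open>- t\<close> released here cancel against
    \<open>real j * t\<close>.\<close>
  also have "(\<Sum>i = 1..j. hinge (a i - t)) = (\<Sum>i = 1..j. a i + hinge (t - a i) - t)"
    by (rule sum.cong) (auto simp: hinge_def)
  also have "\<dots> = (\<Sum>i = 1..j. a i) + (\<Sum>i = 1..j. hinge (t - a i)) - real j * t"
    by (simp add: sum.distrib sum_subtractf)
  finally show ?thesis by (simp add: hinge_objective_def)
qed

text \<open>Both correction sums have nonnegative terms, so equality means that every term vanishes.
  As ranked values decrease, only ranks \<open>j\<close> and \<open>j + 1\<close> matter; the guards
  \<open>j = 0\<close> and \<open>j = n\<close> cover the cases where such a rank does not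
  exist.\<close>

lemma hinge_objective_bound:
  fixes s :: "nat \<Rightarrow> 'a \<Rightarrow> real" and \<theta> :: 'a
  assumes "j \<le> n"
  defines "a \<equiv> ranked_value (score_mset n s \<theta>)"
  shows "(\<Sum>i = 1..j. a i) \<le> hinge_objective j n s \<theta> t" (is ?bound)
    and "hinge_objective j n s \<theta> t = (\<Sum>i = 1..j. a i) \<longleftrightarrow>
      (j = 0 \<or> t \<le> a j) \<and> (j = n \<or> a (j + 1) \<le> t)" (is ?eq)
proof -
  let ?A = "\<Sum>i = 1..j. hinge (t - a i)" and ?B = "\<Sum>i = j + 1..n. hinge (a i - t)"
  have F: "hinge_objective j n s \<theta> t = (\<Sum>i = 1..j. a i) + (?A + ?B)"
    using hinge_objective_ranked[OF assms(1)] by (simp add: a_def)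
  have A: "0 \<le> ?A" and B: "0 \<le> ?B"
    by (auto intro!: sum_nonneg simp: hinge_def)
  show ?bound using F A B by simp
  have anti: "a i' \<le> a i" if "1 \<le> i" "i \<le> i'" "i' \<le> n" for i i'
    using that by (simp add: a_def ranked_value_antimono)
  have "?A = 0 \<longleftrightarrow> (\<forall>i\<in>{1..j}. hinge (t - a i) = 0)"
    by (rule sum_nonneg_eq_0_iff) (auto simp: hinge_def)
  also have "\<dots> \<longleftrightarrow> (\<forall>i\<in>{1..j}. t \<le> a i)"
    by (auto simp: hinge_def max_def)
  also have "\<dots> \<longleftrightarrow> j = 0 \<or> t \<le> a j"
  proof (cases "j = 0")
    case False
    then show ?thesis using anti[of _ j] assms(1) by (auto intro: order_trans)
  qed simp
  finally have A0: "?A = 0 \<longleftrightarrow> j = 0 \<or> t \<le> a j" .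
  have "?B = 0 \<longleftrightarrow> (\<forall>i\<in>{j + 1..n}. hinge (a i - t) = 0)"
    by (rule sum_nonneg_eq_0_iff) (auto simp: hinge_def)
  also have "\<dots> \<longleftrightarrow> (\<forall>i\<in>{j + 1..n}. a i \<le> t)"
    by (auto simp: hinge_def max_def)
  also have "\<dots> \<longleftrightarrow> j = n \<or> a (j + 1) \<le> t"
  proof (cases "j = n")
    case False
    have "a i \<le> t" if "a (j + 1) \<le> t" "i \<in> {j + 1..n}" for i
      using anti[of "j + 1" i] that by simp
    moreover have "j + 1 \<in> {j + 1..n}" using False assms(1) by simp
    ultimately show ?thesis using False by blast
  qed simp
  finally have B0: "?B = 0 \<longleftrightarrow> j = n \<or> a (j + 1) \<le> t" .
  have "x + (y + z) = x \<longleftrightarrow> y = 0 \<and> z = 0" if "0 \<le> y" "0 \<le> z" for x y z :: real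
    using that by linarith
  from this[OF A B] show ?eq unfolding F A0 B0 .
qed

lemma hinge_objective_attained:
  fixes s :: "nat \<Rightarrow> 'a \<Rightarrow> real" and \<theta> :: 'a
  assumes "1 \<le> n" "j \<le> n"
  shows "\<exists>t. hinge_objective j n s \<theta> t = (\<Sum>i = 1..j. ranked_value (score_mset n s \<theta>) i)"
proof -
  let ?a = "ranked_value (score_mset n s \<theta>)"
  have "j = 0 \<or> j = n \<or> ?a (j + 1) \<le> ?a j"
    using ranked_value_antimono[of j "j + 1" "score_mset n s \<theta>"] assms by fastforce
  \<comment> \<open>An endpoint works: \<open>?a (j + 1)\<close> if \<open>j = 0\<close>, and
    \<open>?a j\<close> otherwise.\<close>
  then obtain t where "(j = 0 \<or> t \<le> ?a j) \<and> (j = n \<or> ?a (j + 1) \<le> t)"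
    by (metis order_refl)
  then show ?thesis
    by (intro exI, rule hinge_objective_bound(2)[OF assms(2), THEN iffD2])
qed

text \<open>Since the bound is attained at \<open>x0\<close>, a point above it cannot be minimal.
  This turns the search for minimizers into the equality case of
  \<open>hinge_objective_bound\<close>.\<close>

lemma minimizes_iff_eq_lower_bound:
  fixes f :: "'a \<Rightarrow> 'b::linorder"
  assumes "\<And>y. c \<le> f y" and "f x0 = c"
  shows "minimizes f x \<longleftrightarrow> f x = c"
proof
  assume "minimizes f x"
  then have "\<not> f x0 < f x" unfolding is_arg_min_def by blast
  then show "f x = c" using assms(2) assms(1)[of x] by simp
next
  assume "f x = c"
  then show "minimizes f x" using assms(1) by (simp add: is_arg_min_def not_less)
qed

lemma minimizes_hinge_objective_iff_eq_sum:
  fixes s :: "nat \<Rightarrow> 'a \<Rightarrow> real" and \<theta> :: 'a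
  assumes "1 \<le> n" "j \<le> n"
  shows "minimizes (hinge_objective j n s \<theta>) t \<longleftrightarrow>
    hinge_objective j n s \<theta> t = (\<Sum>i = 1..j. ranked_value (score_mset n s \<theta>) i)"
proof -
  obtain t0 where t0: "hinge_objective j n s \<theta> t0 =
      (\<Sum>i = 1..j. ranked_value (score_mset n s \<theta>) i)"
    by (rule exE[OF hinge_objective_attained[OF assms]])
  show ?thesis
    by (rule minimizes_iff_eq_lower_bound[where f="hinge_objective j n s \<theta>",
          OF hinge_objective_bound(1)[OF assms(2)] t0])
qed

lemma minimizes_hinge_objective_iff:
  fixes s :: "nat \<Rightarrow> 'a \<Rightarrow> real" and \<theta> :: 'a
  assumes "1 \<le> n" "j \<le> n"
  defines "a \<equiv> ranked_value (score_mset n s \<theta>)"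
  shows "minimizes (hinge_objective j n s \<theta>) t \<longleftrightarrow>
    (j = 0 \<or> t \<le> a j) \<and> (j = n \<or> a (j + 1) \<le> t)"
  unfolding minimizes_hinge_objective_iff_eq_sum[OF assms(1,2)] a_def
  by (rule hinge_objective_bound(2)[OF assms(2)])

lemma INF_hinge_objective:
  fixes s :: "nat \<Rightarrow> 'a \<Rightarrow> real" and \<theta> :: 'a
  assumes "1 \<le> n" "j \<le> n"
  shows "(INF t. hinge_objective j n s \<theta> t) =
    (\<Sum>i = 1..j. ranked_value (score_mset n s \<theta>) i)"
proof -
  obtain t0 where t0: "hinge_objective j n s \<theta> t0 =
      (\<Sum>i = 1..j. ranked_value (score_mset n s \<theta>) i)"
    by (rule exE[OF hinge_objective_attained[OF assms]])
  show ?thesis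
  proof (rule cInf_eq_minimum)
    show "(\<Sum>i = 1..j. ranked_value (score_mset n s \<theta>) i) \<in> range (hinge_objective j n s \<theta>)"
      using t0 by (rule range_eqI[OF sym])
  qed (elim rangeE, simp only: hinge_objective_bound(1)[OF assms(2)])
qed

text \<open>Removing the \<open>m\<close> largest scores from the \<open>k\<close> largest leaves
  exactly ranks \<open>m + 1\<close> to \<open>k\<close>.\<close>

lemma hinge_difference_eq_ranked_range_sum:
  assumes "1 \<le> n" "m \<le> k" "k \<le> n"
  shows "hinge_difference m k n s \<theta> = ranked_range_sum m k (score_mset n s \<theta>)"
proof -
  have "(\<Sum>i = 1..k. a i) = (\<Sum>i = 1..m. a i) + (\<Sum>i = m + 1..k. a i)" for a :: "nat \<Rightarrow> real"
    using sum.ub_add_nat[of 1 m a "k - m"] assms(2) by simp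
  moreover have "m \<le> n" using assms(2,3) by simp
  ultimately show ?thesis
    unfolding hinge_difference_def ranked_range_sum_def
    by (simp only: INF_hinge_objective[OF assms(1)] assms(3) add_diff_cancel_left')
qed

text \<open>The infima over \<open>\<theta>\<close> live in \<open>ereal\<close>, so that they are
  meaningful even when the objective is unbounded below. If the values at ranks \<open>k\<close> and
  \<open>m + 1\<close> coincide, taking \<open>t\<close> and \<open>u\<close> both equal to that
  value is optimal, so strictness can fail. Hence \<open>t \<le> u\<close> is asserted for all
  optimal pairs, and \<open>t < u\<close> for some or for all pairs comes with its exact
  condition.\<close>

theorem theorem1:
  fixes s :: "nat \<Rightarrow> real ^ 'd \<Rightarrow> real" and n k m :: nat
  assumes "1 \<le> n" and "m < k" and "k \<le> n"
    and "\<And>i. i \<in> {1..n} \<Longrightarrow> convex_on UNIV (s i)"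
  shows
    "(\<forall>\<theta>. (\<exists>t. minimizes (hinge_objective k n s \<theta>) t) \<and>
          (\<exists>u. minimizes (hinge_objective m n s \<theta>) u)) \<and>
     (INF \<theta>. ereal (ranked_range_sum m k (score_mset n s \<theta>))) =
       (INF \<theta>. ereal (hinge_difference m k n s \<theta>)) \<and>
     (\<forall>\<theta>. minimizes (\<lambda>\<theta>. ranked_range_sum m k (score_mset n s \<theta>)) \<theta> \<longleftrightarrow>
          minimizes (hinge_difference m k n s) \<theta>) \<and>
     (\<forall>\<theta>. minimizes (hinge_difference m k n s) \<theta> \<longrightarrow>
        (\<forall>t u. minimizes (hinge_objective k n s \<theta>) t \<and>
               minimizes (hinge_objective m n s \<theta>) u \<longrightarrow> t \<le> u) \<and>
        ((\<exists>t u. minimizes (hinge_objective k n s \<theta>) t \<and>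
                minimizes (hinge_objective m n s \<theta>) u \<and> t < u) \<longleftrightarrow>
           m = 0 \<or> k = n \<or>
           ranked_value (score_mset n s \<theta>) (k + 1) < ranked_value (score_mset n s \<theta>) m) \<and>
        ((\<forall>t u. minimizes (hinge_objective k n s \<theta>) t \<and>
                minimizes (hinge_objective m n s \<theta>) u \<longrightarrow> t < u) \<longleftrightarrow>
           ranked_value (score_mset n s \<theta>) k < ranked_value (score_mset n s \<theta>) (m + 1)))"
proof -
  \<comment> \<open>The two functions of \<open>\<theta>\<close> are identical, which settles the
    claims on infima and on minimizers over \<open>\<theta>\<close> at once.\<close>
  have eq: "hinge_difference m k n s = (\<lambda>\<theta>. ranked_range_sum m k (score_mset n s \<theta>))"
    using assms(1-3) by (intro ext hinge_difference_eq_ranked_range_sum) simp_all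
  have ex: "\<exists>t. minimizes (hinge_objective j n s \<theta>) t" if "j \<le> n" for j \<theta>
    unfolding minimizes_hinge_objective_iff_eq_sum[OF assms(1) that]
    by (rule hinge_objective_attained[OF assms(1) that])
  have compare: "(\<forall>t u. minimizes (hinge_objective k n s \<theta>) t \<and>
               minimizes (hinge_objective m n s \<theta>) u \<longrightarrow> t \<le> u) \<and>
        ((\<exists>t u. minimizes (hinge_objective k n s \<theta>) t \<and>
                minimizes (hinge_objective m n s \<theta>) u \<and> t < u) \<longleftrightarrow>
           m = 0 \<or> k = n \<or>
           ranked_value (score_mset n s \<theta>) (k + 1) < ranked_value (score_mset n s \<theta>) m) \<and>
        ((\<forall>t u. minimizes (hinge_objective k n s \<theta>) t \<and>
                minimizes (hinge_objective m n s \<theta>) u \<longrightarrow> t < u) \<longleftrightarrow>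
           ranked_value (score_mset n s \<theta>) k < ranked_value (score_mset n s \<theta>) (m + 1))" for \<theta>
  proof -
    define a where "a = ranked_value (score_mset n s \<theta>)"
    have anti: "a j \<le> a i" if "1 \<le> i" "i \<le> j" "j \<le> n" for i j
      using that by (simp add: a_def ranked_value_antimono)
    \<comment> \<open>From \<open>m < k\<close> and \<open>k \<le> n\<close> follow
      \<open>k \<noteq> 0\<close> and \<open>m \<noteq> n\<close>, so each interval keeps only one
      guard.\<close>
    have min_k: "minimizes (hinge_objective k n s \<theta>) t \<longleftrightarrow> t \<le> a k \<and> (k = n \<or> a (k + 1) \<le> t)"
      and min_m: "minimizes (hinge_objective m n s \<theta>) t \<longleftrightarrow> (m = 0 \<or> t \<le> a m) \<and> a (m + 1) \<le> t" for t
      using minimizes_hinge_objective_iff[OF assms(1), of k s \<theta> t]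
        minimizes_hinge_objective_iff[OF assms(1), of m s \<theta> t] assms(2,3)
      by (auto simp: a_def)
    \<comment> \<open>As \<open>m + 1 \<le> k\<close>, the top of the interval for \<open>k\<close>
      lies at or below the bottom of the interval for \<open>m\<close>.\<close>
    have km: "a k \<le> a (m + 1)" using anti assms(2,3) by simp
    have next_k: "k = n \<or> a (k + 1) \<le> a k" using anti[of k "k + 1"] assms(2,3) by linarith
    have prev_m: "m = 0 \<or> a (m + 1) \<le> a m" using anti[of m "m + 1"] assms(2,3) by linarith
    have "\<exists>t u. t \<le> a k \<and> (k = n \<or> a (k + 1) \<le> t) \<and> (m = 0 \<or> u \<le> a m) \<and> a (m + 1) \<le> u \<and> t < u"
      if "m = 0 \<or> k = n \<or> a (k + 1) < a m"
    proof -
      \<comment> \<open>The most favourable pair: the bottom of the interval for \<open>k\<close>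
        and the top of the interval for \<open>m\<close>. Where an interval is unbounded on that
        side, a point at distance 1 beyond its finite end suffices by \<open>km\<close>.\<close>
      define t where "t = (if k = n then a k - 1 else a (k + 1))"
      define u where "u = (if m = 0 then a (m + 1) + 1 else a m)"
      have "t < u" "t \<le> a k" "k = n \<or> a (k + 1) \<le> t" "m = 0 \<or> u \<le> a m" "a (m + 1) \<le> u"
        using that km next_k prev_m by (auto simp: t_def u_def split: if_splits)
      then show ?thesis by blast
    qed
    moreover have "m = 0 \<or> k = n \<or> a (k + 1) < a m"
      if "k = n \<or> a (k + 1) \<le> t" "m = 0 \<or> u \<le> a m" "t < u" for t u
      using that by linarith
    ultimately have some_less: "(\<exists>t u. (t \<le> a k \<and> (k = n \<or> a (k + 1) \<le> t)) \<and>
        ((m = 0 \<or> u \<le> a m) \<and> a (m + 1) \<le> u) \<and> t < u) \<longleftrightarrow> m = 0 \<or> k = n \<or> a (k + 1) < a m"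
      by blast
    have all_less: "(\<forall>t u. (t \<le> a k \<and> (k = n \<or> a (k + 1) \<le> t)) \<and>
        ((m = 0 \<or> u \<le> a m) \<and> a (m + 1) \<le> u) \<longrightarrow> t < u) \<longleftrightarrow> a k < a (m + 1)"
      (is "?L \<longleftrightarrow> ?R")
    proof
      assume ?L
      \<comment> \<open>The facing endpoints \<open>t = a k\<close> and \<open>u = a (m + 1)\<close>
        are the critical pair; \<open>next_k\<close> and \<open>prev_m\<close> place them in their
        intervals.\<close>
      then show ?R using next_k prev_m by blast
    qed force
    show ?thesis
      unfolding a_def[symmetric] min_k min_m some_less all_less using km by force
  qed
  show ?thesis
    unfolding eq using ex[of k] ex[of m] assms(2,3) compare by (intro conjI allI impI refl) simp_all
qed

end
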